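(* Let $\Bbbk$ be a field of characteristic zero and let $d\ge 1$. Suppose that $A$ is a nonassociative $\Bbbk$-algebra that satisfies the identity $w_d=0$. Then the symmetrized product $a_1\circ a_2=a_1a_2+a_2a_1$ on $A$ satisfies the identity $t_d=0$.
   Context: A nonassociative algebra is a $\Bbbk$-vector space $A$ with a bilinear product $(a,b)\mapsto ab$, with no associativity or commutativity assumed. $w_n(a_1,\ldots,a_n)$ is the sum of all bracketings of the product $a_1a_2\cdots a_n$ (arguments in this order); equivalently $w_1(a_1)=a_1$ and $w_n(a_1,\ldots,a_n)=\sum_{i=1}^{n-1}w_i(a_1,\ldots,a_i)\,w_{n-i}(a_{i+1},\ldots,a_n)$. For a commutative (nonassociative) bilinear product on $A$, $t_n(a_1,\ldots,a_n)$ is the sum of all $(2n-3)!!$ distinct multilinear terms of degree $n$ in $a_1,\ldots,a_n$ (each used exactly once, in any order) obtained by iterating the product, where terms that coincide due to commutativity are counted once; equivalently $t_1(a_1)=a_1$ and $t_n(a_1,\ldots,a_n)=\sum t_{|I|}(a_I)\,t_{|J|}(a_J)$, the sum being over all decompositions $I\sqcup J=\{1,\ldots,n\}$ with $1\in I$ and $J\neq\varnothing$. For instance $t_3(a_1,a_2,a_3)=(a_1a_2)a_3+(a_1a_3)a_2+a_1(a_2a_3)$. An identity holds if the operation vanishes for all arguments from $A$. *)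

theory Defs
  imports Complex_Main
begin

locale nonassoc_algebra = vector_space scale
  for scale :: "'k::field \<Rightarrow> 'a::ab_group_add \<Rightarrow> 'a" +
  fixes mul :: "'a \<Rightarrow> 'a \<Rightarrow> 'a"
  assumes linear_mul_left: "Vector_Spaces.linear scale scale (\<lambda>a. mul a b)"
    and linear_mul_right: "Vector_Spaces.linear scale scale (\<lambda>b. mul a b)"

text \<open>
  The \<open>n\<close>-ary operations \<open>w\<^sub>n\<close> and \<open>t\<^sub>n\<close> take their arguments as a list of length \<open>n\<close>.
  The value on the empty list is a dummy; it never occurs in the recursion.
\<close>

function w_op :: "('a \<Rightarrow> 'a \<Rightarrow> 'a) \<Rightarrow> 'a list \<Rightarrow> 'a::comm_monoid_add" where
  "w_op mul as = (case as of [] \<Rightarrow> 0 | [a] \<Rightarrow> a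
     | _ \<Rightarrow> (\<Sum>i = 1..<length as. mul (w_op mul (take i as)) (w_op mul (drop i as))))"
  by auto
termination
  by (relation "measure (\<lambda>(mul, as). length as)") auto

declare w_op.simps [simp del]

lemma length_nths_less:
  assumes "j < length as" "j \<notin> I"
  shows "length (nths as I) < length as"
proof -
  have "{i. i < length as \<and> i \<in> I} \<subset> {..<length as}" using assms by auto
  from psubset_card_mono[OF _ this] show ?thesis by (simp add: length_nths)
qed

text \<open>
  Argument positions are counted from \<open>0\<close>, so the distinguished first argument lies in the
  block \<open>I\<close>. As \<open>nths as I\<close> lists the arguments with positions in \<open>I\<close> in increasing order, it
  is \<open>a\<^sub>I\<close>. This is the sum of all distinct monomials only if \<open>mul\<close> is commutative.
\<close>

function t_op :: "('a \<Rightarrow> 'a \<Rightarrow> 'a) \<Rightarrow> 'a list \<Rightarrow> 'a::comm_monoid_add" where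
  "t_op mul as = (case as of [] \<Rightarrow> 0 | [a] \<Rightarrow> a
     | _ \<Rightarrow> (\<Sum>I | I \<subseteq> {..<length as} \<and> 0 \<in> I \<and> {..<length as} - I \<noteq> {}.
              mul (t_op mul (nths as I)) (t_op mul (nths as ({..<length as} - I)))))"
  by auto
termination
proof (relation "measure (\<lambda>(mul, as). length as)", goal_cases)
  case 1
  then show ?case by simp
next
  case (2 mul as x xs y ys I)
  then obtain j where "j < length as" "j \<notin> I" by auto
  then show ?case by (simp add: length_nths_less)
next
  case (3 mul as x xs y ys I)
  then have "length (nths as ({..<length as} - I)) < length as"
    by (intro length_nths_less[of 0]) auto
  then show ?case by simp
qed

declare t_op.simps [simp del]

definition symmetrized :: "('a \<Rightarrow> 'a \<Rightarrow> 'a) \<Rightarrow> 'a \<Rightarrow> 'a \<Rightarrow> 'a::plus" where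
  "symmetrized mul a b = mul a b + mul b a"

lemma symmetrized_commute:
  fixes mul :: "'a \<Rightarrow> 'a \<Rightarrow> 'a::ab_semigroup_add"
  shows "symmetrized mul a b = symmetrized mul b a"
  by (simp add: symmetrized_def add.commute)

lemma w_op_1: "w_op mul [a] = a"
  by (subst w_op.simps) simp

lemma w_op_2: "w_op mul [a, b] = mul a b"
  by (subst w_op.simps) (simp add: w_op_1)

lemma w_op_3: "w_op mul [a, b, c] = mul a (mul b c) + mul (mul a b) c"
  by (subst w_op.simps) (simp add: w_op_1 w_op_2 numeral_eq_Suc)

lemma t_op_1: "t_op mul [a] = a"
  by (subst t_op.simps) simp

lemma t_op_2: "t_op mul [a, b] = mul a b"
proof -
  have "{I. I \<subseteq> {..<2} \<and> 0 \<in> I \<and> {..<2} - I \<noteq> {}} = {{0::nat}}"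
    by (auto simp: numeral_eq_Suc lessThan_Suc)
  moreover have "{..<2} - {0} = {1::nat}" by auto
  ultimately show ?thesis
    by (subst t_op.simps) (simp add: t_op_1 nths_Cons numeral_2_eq_2)
qed

lemma t_op_3: "t_op mul [a, b, c] = mul (mul a b) c + mul (mul a c) b + mul a (mul b c)"
proof -
  have U: "{..<length [a, b, c]} = {0, 1, 2}" by auto
  have "{I. I \<subseteq> {0, 1, 2} \<and> 0 \<in> I \<and> {0, 1, 2} - I \<noteq> {}} = {{0::nat}, {0, 1}, {0, 2}}"
    (is "?L = ?R")
  proof
    have "?L \<subseteq> {I \<in> Pow {0, 1, 2}. 0 \<in> I \<and> I \<noteq> {0, 1, 2}}" by auto
    also have "\<dots> \<subseteq> ?R"
      unfolding Pow_insert Pow_empty by auto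
    finally show "?L \<subseteq> ?R" .
  next
    show "?R \<subseteq> ?L" by auto
  qed
  moreover have "{0, 1, 2} - {0} = {1, 2::nat}" "{0, 1, 2} - {0, 1} = {2::nat}"
    "{0, 1, 2} - {0, 2} = {1::nat}" by auto
  moreover have "nths [a, b, c] {0} = [a]" "nths [a, b, c] {1} = [b]" "nths [a, b, c] {2} = [c]"
    "nths [a, b, c] {0, 1} = [a, b]" "nths [a, b, c] {0, 2} = [a, c]" "nths [a, b, c] {1, 2} = [b, c]"
    by (simp_all add: nths_Cons)
  moreover have "{0} \<notin> {{0, 1}, {0, 2::nat}}" "{0, 1} \<notin> {{0, 2::nat}}"
    by (auto simp: doubleton_eq_iff)
  ultimately show ?thesis
    by (subst t_op.simps, unfold U list.case)
      (simp only: finite.intros sum.insert sum.empty empty_iff not_False_eq_True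
        t_op_1 t_op_2 add_0_left add_0_right add.commute add.left_commute add.assoc)
qed

end

theory Submission
  imports Defs "HOL-Combinatorics.Multiset_Permutations"
begin

text \<open>
  The identity behind the theorem is
  \<open>t\<^sub>n(a\<^sub>1, \<dots>, a\<^sub>n) = \<Sum>\<^sub>\<sigma> w\<^sub>n(a\<^bsub>\<sigma>(1)\<^esub>, \<dots>, a\<^bsub>\<sigma>(n)\<^esub>)\<close>,
  where \<open>t\<^sub>n\<close> is formed with the symmetrized product: expanding every \<open>\<circ>\<close> in a commutative monomial
  lists each planar binary tree with labelled leaves exactly once. Inductively, cutting a permuted
  word into a prefix and a suffix amounts to choosing an ordered decomposition \<open>I \<squnion> J\<close> of the
  argument set, and \<open>(I, J)\<close> and \<open>(J, I)\<close> together give the symmetrized product of the two blocks.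
\<close>

text \<open>The sum runs over orderings of a set of labels rather than of the arguments themselves:
  equal arguments keep separate labels, and the blocks of a decomposition are again sets to which
  \<open>w_sym\<close> applies.\<close>

definition w_sym :: "('a \<Rightarrow> 'a \<Rightarrow> 'a) \<Rightarrow> ('i \<Rightarrow> 'a) \<Rightarrow> 'i set \<Rightarrow> 'a::comm_monoid_add" where
  "w_sym mul f S = (\<Sum>xs\<in>permutations_of_set S. w_op mul (map f xs))"

lemma w_op_rec:
  assumes "length as \<ge> 2"
  shows "w_op mul as = (\<Sum>i = 1..<length as. mul (w_op mul (take i as)) (w_op mul (drop i as)))"
  using assms by (subst w_op.simps) (auto split: list.split)

lemma t_op_rec:
  assumes "length as \<ge> 2"
  shows "t_op mul as = (\<Sum>I | I \<subseteq> {..<length as} \<and> 0 \<in> I \<and> {..<length as} - I \<noteq> {}.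
    mul (t_op mul (nths as I)) (t_op mul (nths as ({..<length as} - I))))"
  using assms by (subst t_op.simps) (auto split: list.split)

text \<open>An ordering of \<open>S\<close> cut at an interior position amounts to the set
  \<open>I\<close> of letters before the cut together with an ordering of \<open>I\<close> and one
  of \<open>S - I\<close>. Concatenation is the inverse, with the cut recovered as
  \<open>length us\<close>.\<close>

lemma sum_permutations_split:
  fixes g :: "'i list \<Rightarrow> 'i list \<Rightarrow> 'b::comm_monoid_add"
  assumes "finite S"
  shows "(\<Sum>xs\<in>permutations_of_set S. \<Sum>i = 1..<card S. g (take i xs) (drop i xs)) =
    (\<Sum>I | I \<subseteq> S \<and> I \<noteq> {} \<and> S - I \<noteq> {}.
      \<Sum>us\<in>permutations_of_set I. \<Sum>vs\<in>permutations_of_set (S - I). g us vs)"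
proof -
  let ?A = "SIGMA xs:permutations_of_set S. {1..<card S}"
  let ?D = "{I. I \<subseteq> S \<and> I \<noteq> {} \<and> S - I \<noteq> {}}"
  let ?B = "SIGMA I:?D. permutations_of_set I \<times> permutations_of_set (S - I)"
  have "finite ?D" using assms by auto
  have "(\<Sum>(xs, i)\<in>?A. g (take i xs) (drop i xs)) = (\<Sum>(I, us, vs)\<in>?B. g us vs)"
  proof (rule sum.reindex_bij_witness[where i = "\<lambda>(I, us, vs). (us @ vs, length us)"
        and j = "\<lambda>(xs, i). (set (take i xs), take i xs, drop i xs)"], goal_cases)
    case (1 p)
    then show ?case by (auto simp: permutations_of_set_def distinct_card)
  next
    case (2 p)
    then obtain xs i where p: "p = (xs, i)" "set xs = S" "distinct xs" "1 \<le> i" "i < card S"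
      by (auto simp: permutations_of_set_def)
    then have len: "length xs = card S" using distinct_card[of xs] by simp
    \<comment> \<open>Disjointness and union identify the letters of the suffix as exactly the
      complement of those of the prefix.\<close>
    have disj: "set (take i xs) \<inter> set (drop i xs) = {}"
      using p by (simp add: set_take_disj_set_drop_if_distinct)
    have un: "set (take i xs) \<union> set (drop i xs) = S"
      using p(2) by (metis append_take_drop_id set_append)
    have "set (take i xs) \<noteq> {}" "set (drop i xs) \<noteq> {}"
      using p len by auto
    moreover from disj un have "set (drop i xs) = S - set (take i xs)" "set (take i xs) \<subseteq> S"
      by blast+
    ultimately have "set (take i xs) \<in> ?D" "take i xs \<in> permutations_of_set (set (take i xs))"
      "drop i xs \<in> permutations_of_set (S - set (take i xs))"
      using p(3) by (auto simp only: permutations_of_set_def mem_Collect_eq distinct_take distinct_drop)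
    then show ?case unfolding p(1) prod.case by (intro SigmaI)
  next
    case (3 q)
    then show ?case by (auto simp: permutations_of_set_def)
  next
    case (4 q)
    then obtain I us vs where q: "q = (I, us, vs)" "I \<subseteq> S" "I \<noteq> {}" "S - I \<noteq> {}"
      "set us = I" "distinct us" "set vs = S - I" "distinct vs"
      by (auto simp: permutations_of_set_def)
    have "distinct (us @ vs)" "set (us @ vs) = S" using q by auto
    moreover from this have "card S = length us + length vs"
      by (metis distinct_card length_append)
    moreover have "us \<noteq> []" "vs \<noteq> []" using q by auto
    ultimately show ?case using q(1)
      by (auto simp: permutations_of_set_def Suc_le_eq)
  next
    case (5 p)
    then show ?case by auto
  qed
  moreover have "(\<Sum>(I, us, vs)\<in>?B. g us vs) =
      (\<Sum>I\<in>?D. \<Sum>(us, vs)\<in>permutations_of_set I \<times> permutations_of_set (S - I). g us vs)"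
    using \<open>finite ?D\<close> by (intro sum.Sigma[symmetric]) auto
  ultimately show ?thesis
    by (simp only: sum.cartesian_product)
qed

text \<open>Cut every permuted word by the recursion of \<open>w_op\<close>, regroup the cuts by the
  letters of the prefix, and use biadditivity to factor each double sum into a product.\<close>

lemma w_sym_rec:
  fixes mul :: "'a \<Rightarrow> 'a \<Rightarrow> 'a::ab_group_add"
  assumes add_left: "\<And>b. additive (\<lambda>a. mul a b)" and add_right: "\<And>a. additive (mul a)"
    and "finite S" "card S \<ge> 2"
  shows "w_sym mul f S = (\<Sum>I | I \<subseteq> S \<and> I \<noteq> {} \<and> S - I \<noteq> {}. mul (w_sym mul f I) (w_sym mul f (S - I)))"
proof -
  have "w_sym mul f S = (\<Sum>xs\<in>permutations_of_set S. \<Sum>i = 1..<card S.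
      mul (w_op mul (map f (take i xs))) (w_op mul (map f (drop i xs))))"
    unfolding w_sym_def
  proof (rule sum.cong[OF refl])
    fix xs assume "xs \<in> permutations_of_set S"
    then have "length xs = card S"
      by (auto simp: permutations_of_set_def distinct_card)
    then show "w_op mul (map f xs) = (\<Sum>i = 1..<card S.
      mul (w_op mul (map f (take i xs))) (w_op mul (map f (drop i xs))))"
      using \<open>card S \<ge> 2\<close> by (subst w_op_rec) (simp_all add: take_map drop_map)
  qed
  also have "\<dots> = (\<Sum>I | I \<subseteq> S \<and> I \<noteq> {} \<and> S - I \<noteq> {}.
      \<Sum>us\<in>permutations_of_set I. \<Sum>vs\<in>permutations_of_set (S - I).
        mul (w_op mul (map f us)) (w_op mul (map f vs)))"
    using \<open>finite S\<close> by (rule sum_permutations_split)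
  also have "\<dots> = (\<Sum>I | I \<subseteq> S \<and> I \<noteq> {} \<and> S - I \<noteq> {}. mul (w_sym mul f I) (w_sym mul f (S - I)))"
    \<comment> \<open>Expanding the product of the two sums leaves the sum over the second factor
      outermost, hence the final swap.\<close>
    unfolding w_sym_def additive.sum[OF add_left] additive.sum[OF add_right]
    by (rule sum.cong[OF refl], rule sum.swap)
  finally show ?thesis .
qed

text \<open>Exactly one of \<open>I\<close> and \<open>S - I\<close> contains \<open>s\<close>, so
  ordered splittings pair up under complementation. For \<open>h I J\<close> a product of block
  values, each pair contributes a symmetrized product, as in the recursion of
  \<open>t_op\<close>.\<close>

lemma sum_splits_pointed:
  fixes h :: "'i set \<Rightarrow> 'i set \<Rightarrow> 'b::comm_monoid_add"
  assumes "finite S" "s \<in> S"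
  shows "(\<Sum>I | I \<subseteq> S \<and> I \<noteq> {} \<and> S - I \<noteq> {}. h I (S - I)) =
    (\<Sum>I | I \<subseteq> S \<and> s \<in> I \<and> S - I \<noteq> {}. h I (S - I) + h (S - I) I)"
proof -
  let ?P = "{I. I \<subseteq> S \<and> s \<in> I \<and> S - I \<noteq> {}}" and ?N = "{I. I \<subseteq> S \<and> s \<notin> I \<and> I \<noteq> {}}"
  have eq: "{I. I \<subseteq> S \<and> I \<noteq> {} \<and> S - I \<noteq> {}} = ?P \<union> ?N" using \<open>s \<in> S\<close> by auto
  have "(\<Sum>I\<in>?N. h I (S - I)) = (\<Sum>I\<in>?P. h (S - I) I)"
    by (rule sum.reindex_bij_witness[where i = "\<lambda>I. S - I" and j = "\<lambda>I. S - I"])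
      (use \<open>s \<in> S\<close> in \<open>auto simp: double_diff\<close>)
  moreover have "(\<Sum>I\<in>?P \<union> ?N. h I (S - I)) = (\<Sum>I\<in>?P. h I (S - I)) + (\<Sum>I\<in>?N. h I (S - I))"
    using \<open>finite S\<close> by (intro sum.union_disjoint) auto
  ultimately show ?thesis unfolding eq by (simp add: sum.distrib)
qed

lemma set_nths_image: "I \<subseteq> {..<length xs} \<Longrightarrow> set (nths xs I) = (!) xs ` I"
  by (auto simp: set_nths)

text \<open>Strong induction on the length: after positions are translated into labels, the
  recursion of \<open>t_op\<close> becomes that of \<open>w_sym\<close> with complementary blocks
  paired by \<open>ys ! 0\<close>.\<close>

lemma t_op_symmetrized_eq_w_sym:
  fixes mul :: "'a \<Rightarrow> 'a \<Rightarrow> 'a::ab_group_add"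
  assumes add_left: "\<And>b. additive (\<lambda>a. mul a b)" and add_right: "\<And>a. additive (mul a)"
    and "distinct ys" "ys \<noteq> []"
  shows "t_op (symmetrized mul) (map f ys) = w_sym mul f (set ys)"
  using assms(3,4)
proof (induction ys rule: length_induct)
  case (1 ys)
  let ?n = "length ys" and ?S = "set ys"
  let ?h = "\<lambda>I. symmetrized mul (w_sym mul f I) (w_sym mul f (?S - I))"
  show ?case
  proof (cases "?n \<ge> 2")
    case False
    then obtain y where "ys = [y]" using "1.prems" by (cases ys; cases "tl ys") auto
    then show ?thesis by (simp add: w_sym_def t_op_1 w_op_1)
  next
    case True
    let ?Q = "{I. I \<subseteq> {..<?n} \<and> 0 \<in> I \<and> {..<?n} - I \<noteq> {}}"
    have inj: "inj_on ((!) ys) {..<?n}" and S: "(!) ys ` {..<?n} = ?S"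
      using "1.prems" by (auto simp: inj_on_def nth_eq_iff_index_eq in_set_conv_nth)
    have diff: "(!) ys ` ({..<?n} - I) = ?S - (!) ys ` I" if "I \<subseteq> {..<?n}" for I
      using inj_on_image_set_diff[OF inj, of "{..<?n}" I] that S by auto
    \<comment> \<open>Since the labels are distinct, \<open>(!) ys\<close> is a bijection from
      positions to labels; it carries position \<open>0\<close> to the distinguished label
      \<open>ys ! 0\<close>.\<close>
    have "bij_betw ((`) ((!) ys)) ?Q {J. J \<subseteq> ?S \<and> ys ! 0 \<in> J \<and> ?S - J \<noteq> {}}"
    proof (rule bij_betw_subset)
      show "bij_betw ((`) ((!) ys)) (Pow {..<?n}) (Pow ?S)"
        using inj S by (intro bij_betw_Pow) (simp add: bij_betw_def)
      show "(`) ((!) ys) ` ?Q = {J. J \<subseteq> ?S \<and> ys ! 0 \<in> J \<and> ?S - J \<noteq> {}}"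
      proof (intro equalityI subsetI)
        fix J assume "J \<in> (`) ((!) ys) ` ?Q"
        then obtain I where I: "I \<in> ?Q" "J = (!) ys ` I" by blast
        with diff[of I] S show "J \<in> {J. J \<subseteq> ?S \<and> ys ! 0 \<in> J \<and> ?S - J \<noteq> {}}"
          by fastforce
      next
        fix J assume J: "J \<in> {J. J \<subseteq> ?S \<and> ys ! 0 \<in> J \<and> ?S - J \<noteq> {}}"
        define I where "I = {i\<in>{..<?n}. ys ! i \<in> J}"
        have "J = (!) ys ` I" using J S unfolding I_def by auto
        moreover have "I \<noteq> {..<?n}" using J S calculation by auto
        then have "I \<in> ?Q" using J True unfolding I_def by auto
        ultimately show "J \<in> (`) ((!) ys) ` ?Q" by blast
      qed
    qed auto
    then have "(\<Sum>I\<in>?Q. ?h ((!) ys ` I)) = (\<Sum>J | J \<subseteq> ?S \<and> ys ! 0 \<in> J \<and> ?S - J \<noteq> {}. ?h J)"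
      by (rule sum.reindex_bij_betw)
    also have "\<dots> = w_sym mul f ?S"
    proof -
      have "ys ! 0 \<in> ?S" using "1.prems" by auto
      moreover have "card ?S \<ge> 2" using "1.prems" True by (simp add: distinct_card)
      ultimately show ?thesis
        using sum_splits_pointed[of ?S "ys ! 0" "\<lambda>I J. mul (w_sym mul f I) (w_sym mul f J)"]
        by (simp add: w_sym_rec[OF add_left add_right, where S = ?S] symmetrized_def)
    qed
    finally have rec: "(\<Sum>I\<in>?Q. ?h ((!) ys ` I)) = w_sym mul f ?S" .
    have IH: "t_op (symmetrized mul) (map f (nths ys I)) = w_sym mul f ((!) ys ` I)"
      if "I \<subseteq> {..<?n}" "I \<noteq> {}" "{..<?n} - I \<noteq> {}" for I
    proof -
      from that obtain j where "j < ?n" "j \<notin> I" by auto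
      then have "length (nths ys I) < ?n" by (rule length_nths_less)
      moreover have "nths ys I \<noteq> []" using that set_nths_image[of I ys] by force
      ultimately show ?thesis
        using "1.IH" "1.prems" that by (simp add: set_nths_image)
    qed
    have "t_op (symmetrized mul) (map f ys) = (\<Sum>I\<in>?Q. ?h ((!) ys ` I))"
    proof (subst t_op_rec)
      show "2 \<le> length (map f ys)" using True by simp
      show "(\<Sum>I | I \<subseteq> {..<length (map f ys)} \<and> 0 \<in> I \<and> {..<length (map f ys)} - I \<noteq> {}.
          symmetrized mul (t_op (symmetrized mul) (nths (map f ys) I))
            (t_op (symmetrized mul) (nths (map f ys) ({..<length (map f ys)} - I)))) =
        (\<Sum>I\<in>?Q. ?h ((!) ys ` I))"
      proof (rule sum.cong)
        fix I assume "I \<in> ?Q"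
        then have I: "I \<subseteq> {..<?n}" "0 \<in> I" "{..<?n} - I \<noteq> {}" by auto
        \<comment> \<open>This is the properness condition that \<open>IH\<close> demands of the
          complementary block; it holds because position \<open>0\<close> lies in
          \<open>I\<close>.\<close>
        have "{..<?n} - ({..<?n} - I) \<noteq> {}" using I by auto
        with I show "symmetrized mul (t_op (symmetrized mul) (nths (map f ys) I))
            (t_op (symmetrized mul) (nths (map f ys) ({..<length (map f ys)} - I))) = ?h ((!) ys ` I)"
          using IH[of I] IH[of "{..<?n} - I"] by (force simp: nths_map diff)
      qed simp
    qed
    with rec show ?thesis by simp
  qed
qed

theorem proposition2:
  fixes scale :: "'k::field_char_0 \<Rightarrow> 'a::ab_group_add \<Rightarrow> 'a"
    and mul :: "'a \<Rightarrow> 'a \<Rightarrow> 'a"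
    and d :: nat
  assumes "nonassoc_algebra scale mul"
    and "d \<ge> 1"
    and "\<forall>as. length as = d \<longrightarrow> w_op mul as = 0"
  shows "\<forall>as. length as = d \<longrightarrow> t_op (symmetrized mul) as = 0"
proof (intro allI impI)
  fix as :: "'a list" assume len: "length as = d"
  interpret nonassoc_algebra scale mul by fact
  \<comment> \<open>Positions serve as labels, so the labels are distinct even when
    \<open>as\<close> has repeated entries.\<close>
  have "t_op (symmetrized mul) (map ((!) as) [0..<d]) = w_sym mul ((!) as) (set [0..<d])"
    using \<open>d \<ge> 1\<close> linear_mul_left linear_mul_right
    by (intro t_op_symmetrized_eq_w_sym) (auto simp: additive_def Vector_Spaces.linear_iff)
  also have "\<dots> = 0"
    \<comment> \<open>Every ordering of the \<open>d\<close> labels has length \<open>d\<close>, so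
      the identity \<open>w_d = 0\<close> kills each summand.\<close>
    unfolding w_sym_def using assms(3)
    by (intro sum.neutral) (auto simp: permutations_of_set_def dest: distinct_card)
  finally show "t_op (symmetrized mul) as = 0"
    using len by (auto simp: map_nth)
qed

end
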